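(* Let $\mathbf{W},\widetilde{\mathbf{W}}\in\mathbb{C}^{n\times n}$ and suppose $\widetilde{\mathbf{W}}\approx_\epsilon\mathbf{W}$ for some $\epsilon\in(0,2/3)$. Let $F\subseteq[n]$ be such that $\mathbf{I}_{|F|}-\mathbf{W}_{FF}$ is invertible, and let $C=[n]\setminus F$. Then $$\mathbf{I}_{|C|}-\mathrm{Sc}(\mathbf{I}_n-\widetilde{\mathbf{W}},C)\approx_{\epsilon/(1-3\epsilon/2)}\mathbf{I}_{|C|}-\mathrm{Sc}(\mathbf{I}_n-\mathbf{W},C).$$
   Context: For $\mathbf{A}\in\mathbb{C}^{m\times m}$, $\mathbf{A}^*$ is its conjugate transpose. For $\mathbf{W},\widetilde{\mathbf{W}}\in\mathbb{C}^{m\times m}$, $\widetilde{\mathbf{W}}\approx_\epsilon\mathbf{W}$ (complex $\epsilon$-approximation) means that for all $x,y\in\mathbb{C}^m$, $|x^*(\mathbf{W}-\widetilde{\mathbf{W}})y|\le\frac{\epsilon}{2}(\|x\|^2+\|y\|^2-\mathrm{Re}(x^*\mathbf{W}x+y^*\mathbf{W}y))$. For a matrix $\mathbf{M}$ and index sets $S,T$, $\mathbf{M}_{ST}$ is the submatrix with rows $S$ and columns $T$. If $F,C$ partition $[n]$ and $\mathbf{M}_{FF}$ is invertible, the Schur complement of $\mathbf{M}$ onto $C$ is $\mathrm{Sc}(\mathbf{M},C)=\mathbf{M}_{CC}-\mathbf{M}_{CF}\mathbf{M}_{FF}^{-1}\mathbf{M}_{FC}$, a $|C|\times|C|$ matrix.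 *)

theory Defs
  imports
    "Jordan_Normal_Form.DL_Submatrix"
    "Jordan_Normal_Form.Gauss_Jordan_Elimination"
begin

definition sq_norm_cvec :: "complex vec \<Rightarrow> real" where
  "sq_norm_cvec x = (\<Sum>i<dim_vec x. (cmod (x $ i))\<^sup>2)"

text \<open>The scalar \<open>x\<^sup>* M y\<close>.\<close>

definition sesq :: "complex vec \<Rightarrow> complex mat \<Rightarrow> complex vec \<Rightarrow> complex" where
  "sesq x M y = conjugate x \<bullet> (M *\<^sub>v y)"

text \<open>\<open>complex_approx m \<epsilon> V W\<close> states that \<open>V\<close> is a complex \<open>\<epsilon>\<close>-approximation of \<open>W\<close>;
  the relation is not symmetric, since only \<open>W\<close> occurs in the error term.\<close>

definition complex_approx :: "nat \<Rightarrow> real \<Rightarrow> complex mat \<Rightarrow> complex mat \<Rightarrow> bool" where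
  "complex_approx m \<epsilon> V W \<longleftrightarrow>
     V \<in> carrier_mat m m \<and> W \<in> carrier_mat m m \<and>
     (\<forall>x \<in> carrier_vec m. \<forall>y \<in> carrier_vec m.
        cmod (sesq x (W - V) y) \<le>
          \<epsilon> / 2 * (sq_norm_cvec x + sq_norm_cvec y - Re (sesq x W x + sesq y W y)))"

text \<open>Indices range over \<open>{0..<n}\<close> with \<open>n = dim_row M\<close>. The value is meaningful only for square
  \<open>M\<close> with \<open>C \<subseteq> {0..<n}\<close> and an invertible block \<open>submatrix M F F\<close>; otherwise \<open>mat_inverse\<close> may
  return \<open>None\<close> and the term is unspecified.\<close>

definition schur_complement :: "complex mat \<Rightarrow> nat set \<Rightarrow> complex mat" where
  "schur_complement M C =
     (let F = {0..<dim_row M} - C in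
        submatrix M C C - submatrix M C F * the (mat_inverse (submatrix M F F)) * submatrix M F C)"

end

theory Submission
  imports Defs "Jordan_Normal_Form.Determinant"
begin

text \<open>
  Put \<open>L = I - W\<close>, \<open>L' = I - W'\<close>, with Schur complements \<open>S\<close>, \<open>S'\<close> onto \<open>C\<close>, and
  \<open>q x = Re (x\<^sup>* L x) \<ge> 0\<close>. Extend \<open>b\<close> to \<open>y\<close> with \<open>L y = (S b, 0)\<close>, and \<open>a\<close> to \<open>x\<close> with
  \<open>x\<^sup>* L' = (a\<^sup>* S', 0)\<close>. Then \<open>a\<^sup>* (S - S') b = x\<^sup>* (L - L') y\<close> and \<open>q y = Re (b\<^sup>* S b)\<close>.
  Rescaling \<open>x\<close> and \<open>y\<close> in the hypothesis bounds this by
  \<open>\<epsilon> / 2 * ((1 - \<epsilon>) * q x + q y / (1 - \<epsilon>))\<close>. The case \<open>b = a\<close>, together with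
  \<open>(1 - \<epsilon>) * q x \<le> Re (x\<^sup>* L' x) = Re (a\<^sup>* S' a)\<close>, gives \<open>(1 - \<epsilon>) * q x \<le> Re (a\<^sup>* S a) / (1 - \<epsilon>)\<close>,
  hence an approximation with constant \<open>\<epsilon> / (1 - \<epsilon>) \<le> \<epsilon> / (1 - 3 * \<epsilon> / 2)\<close>.
\<close>

section \<open>Subvectors and block decomposition\<close>

text \<open>The enumeration \<open>pick\<close> is the one used by \<open>submatrix\<close>, so
  entries of a subvector line up with rows and columns of the blocks.\<close>

definition subvec :: "'a vec \<Rightarrow> nat set \<Rightarrow> 'a vec" where
  "subvec x I = vec (card I) (\<lambda>i. x $ pick I i)"

lemma subvec_carrier [simp]: "subvec x I \<in> carrier_vec (card I)"
  by (simp add: subvec_def)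

lemma dim_subvec [simp]: "dim_vec (subvec x I) = card I"
  by (simp add: subvec_def)

lemma bij_betw_pick:
  assumes "finite I"
  shows "bij_betw (pick I) {0..<card I} I"
proof -
  have "inj_on (pick I) {0..<card I}"
    by (rule inj_onI) (metis atLeastLessThan_iff card_pick_le)
  moreover have "pick I ` {0..<card I} \<subseteq> I"
    using pick_in_set_le by auto
  ultimately show ?thesis
    using assms by (simp add: bij_betw_def card_image card_subset_eq)
qed

lemma pick_less:
  assumes "I \<subseteq> {0..<n}" "i < card I"
  shows "pick I i < n"
  using assms pick_in_set_le[of i I] by auto

text \<open>The left-hand set is the one in which \<open>dim_submatrix\<close> and
  \<open>submatrix_index\<close> express the dimensions of a block.\<close>

lemma card_restrict_eq:
  assumes "I \<subseteq> {0..<n}"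
  shows "card {i. i < n \<and> i \<in> I} = card I"
  using assms by (intro arg_cong[where f = card]) auto

lemma submatrix_carrier:
  assumes "A \<in> carrier_mat n n" "I \<subseteq> {0..<n}" "J \<subseteq> {0..<n}"
  shows "submatrix A I J \<in> carrier_mat (card I) (card J)"
  using assms by (auto simp: dim_submatrix card_restrict_eq)

lemma submatrix_nth:
  assumes "A \<in> carrier_mat n n" "I \<subseteq> {0..<n}" "J \<subseteq> {0..<n}" "i < card I" "j < card J"
  shows "submatrix A I J $$ (i, j) = A $$ (pick I i, pick J j)"
  using assms by (intro submatrix_index) (auto simp: card_restrict_eq)

text \<open>Since \<open>pick F\<close> is injective, the \<open>F\<close> block of the identity is
  again an identity. This turns the invertibility hypothesis on \<open>W\<close> into one on a block
  of \<open>I - W\<close>.\<close>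

lemma submatrix_one_minus:
  fixes W :: "'a :: ring_1 mat"
  assumes W: "W \<in> carrier_mat n n" and F: "F \<subseteq> {0..<n}"
  shows "submatrix (1\<^sub>m n - W) F F = 1\<^sub>m (card F) - submatrix W F F"
proof (rule eq_matI)
  have inj: "inj_on (pick F) {0..<card F}"
    using F bij_betw_pick[of F] finite_subset by (auto simp: bij_betw_def)
  fix i j assume "i < dim_row (1\<^sub>m (card F) - submatrix W F F)"
    "j < dim_col (1\<^sub>m (card F) - submatrix W F F)"
  then have ij: "i < card F" "j < card F"
    using submatrix_carrier[OF W F F] by auto
  then have "pick F i = pick F j \<longleftrightarrow> i = j"
    using inj by (auto simp: inj_on_def)
  moreover have "1\<^sub>m n - W \<in> carrier_mat n n"
    using W by (simp add: minus_carrier_mat)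
  ultimately show "submatrix (1\<^sub>m n - W) F F $$ (i, j) = (1\<^sub>m (card F) - submatrix W F F) $$ (i, j)"
    using ij W F submatrix_carrier[OF W F F] by (simp add: submatrix_nth pick_less)
qed (use W F in \<open>auto simp: dim_submatrix card_restrict_eq\<close>)

lemma scalar_prod_subvec:
  fixes x y :: "'a :: comm_semiring_0 vec"
  assumes "x \<in> carrier_vec n" "y \<in> carrier_vec n" "F \<subseteq> {0..<n}" "C = {0..<n} - F"
  shows "x \<bullet> y = subvec x C \<bullet> subvec y C + subvec x F \<bullet> subvec y F"
proof -
  have fin: "finite F" "finite C"
    using assms finite_subset by auto
  have part: "(\<Sum>i\<in>I. x $ i * y $ i) = subvec x I \<bullet> subvec y I" if "finite I" for I
    using sum.reindex_bij_betw[OF bij_betw_pick[OF that], of "\<lambda>i. x $ i * y $ i"]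
    by (simp add: scalar_prod_def subvec_def)
  have "x \<bullet> y = (\<Sum>i\<in>{0..<n}. x $ i * y $ i)"
    using assms by (simp add: scalar_prod_def)
  also have "{0..<n} = C \<union> F"
    using assms by auto
  also have "(\<Sum>i\<in>C \<union> F. x $ i * y $ i) = (\<Sum>i\<in>C. x $ i * y $ i) + (\<Sum>i\<in>F. x $ i * y $ i)"
    using fin assms by (intro sum.union_disjoint) auto
  finally show ?thesis
    using part fin by simp
qed

text \<open>Restricting a row of \<open>A\<close> to \<open>C\<close> or \<open>F\<close> gives a
  row of a block, so the split of the scalar product over \<open>C\<close> and \<open>F\<close>
  applies row by row.\<close>

lemma subvec_mult_mat_vec:
  fixes A :: "'a :: comm_semiring_0 mat"
  assumes A: "A \<in> carrier_mat n n" and y: "y \<in> carrier_vec n"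
    and F: "F \<subseteq> {0..<n}" and C: "C = {0..<n} - F" and I: "I \<subseteq> {0..<n}"
  shows "subvec (A *\<^sub>v y) I = submatrix A I C *\<^sub>v subvec y C + submatrix A I F *\<^sub>v subvec y F"
proof (rule eq_vecI)
  have CF: "C \<subseteq> {0..<n}"
    using C by auto
  note car = submatrix_carrier[OF A I CF] submatrix_carrier[OF A I F]
  fix i assume "i < dim_vec (submatrix A I C *\<^sub>v subvec y C + submatrix A I F *\<^sub>v subvec y F)"
  then have i: "i < card I"
    using car by auto
  have p: "pick I i < n"
    using I i by (rule pick_less)
  have row: "subvec (row A (pick I i)) J = row (submatrix A I J) i" if "J \<subseteq> {0..<n}" for J
    using submatrix_carrier[OF A I that] that A I i p
    by (intro eq_vecI) (auto simp: subvec_def submatrix_nth pick_less)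
  have "subvec (A *\<^sub>v y) I $ i = row A (pick I i) \<bullet> y"
    using A i p by (simp add: subvec_def)
  also have "\<dots> = row (submatrix A I C) i \<bullet> subvec y C + row (submatrix A I F) i \<bullet> subvec y F"
    using scalar_prod_subvec[OF row_carrier_vec[OF p A] y F C] F CF by (simp add: row)
  finally show "subvec (A *\<^sub>v y) I $ i =
      (submatrix A I C *\<^sub>v subvec y C + submatrix A I F *\<^sub>v subvec y F) $ i"
    using i car by simp
qed (use submatrix_carrier[OF A I F] in auto)

lemma subvec_glue:
  assumes u: "u \<in> carrier_vec (card C)" and v: "v \<in> carrier_vec (card F)"
    and F: "F \<subseteq> {0..<n}" and C: "C = {0..<n} - F"
  obtains x where "x \<in> carrier_vec n" "subvec x C = u" "subvec x F = v"
proof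
  \<comment> \<open>The number of elements of \<open>F\<close> below \<open>i\<close> is the
    position of \<open>i\<close> in \<open>F\<close>, so these counts invert \<open>pick F\<close>
    and \<open>pick C\<close>.\<close>
  define x where "x = vec n (\<lambda>i. if i \<in> F then v $ card {a\<in>F. a < i} else u $ card {a\<in>C. a < i})"
  show "x \<in> carrier_vec n"
    by (simp add: x_def)
  show "subvec x F = v"
  proof (rule eq_vecI)
    fix i assume "i < dim_vec v"
    then have "i < card F"
      using v by simp
    then show "subvec x F $ i = v $ i"
      using pick_in_set_le[of i F] card_pick_le[of i F] pick_less[OF F, of i]
      by (simp add: subvec_def x_def)
  qed (use v in simp)
  show "subvec x C = u"
  proof (rule eq_vecI)
    fix i assume "i < dim_vec u"
    then have i: "i < card C"
      using u by simp
    then have "pick C i \<in> C"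
      by (rule pick_in_set_le)
    then show "subvec x C $ i = u $ i"
      using card_pick_le[OF i] C i by (simp add: subvec_def x_def)
  qed (use u in simp)
qed

lemma subvec_conjugate:
  assumes "x \<in> carrier_vec n" "I \<subseteq> {0..<n}"
  shows "subvec (conjugate x) I = conjugate (subvec x I)"
  using assms by (intro eq_vecI) (auto simp: subvec_def pick_less)

section \<open>Sesquilinear forms\<close>

lemma sesq_minus:
  assumes "A \<in> carrier_mat n n" "B \<in> carrier_mat n n" "x \<in> carrier_vec n" "y \<in> carrier_vec n"
  shows "sesq x (A - B) y = sesq x A y - sesq x B y"
  using assms by (simp add: sesq_def minus_mult_distrib_mat_vec scalar_prod_minus_distrib[where n = n])

lemma sesq_smult:
  assumes "A \<in> carrier_mat n n" "x \<in> carrier_vec n" "y \<in> carrier_vec n"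
  shows "sesq (c \<cdot>\<^sub>v x) A (d \<cdot>\<^sub>v y) = cnj c * d * sesq x A y"
  using assms by (simp add: sesq_def conjugate_smult_vec mult_mat_vec[of A n n])

lemma sq_norm_cvec_conv_sesq:
  assumes "x \<in> carrier_vec n"
  shows "sesq x (1\<^sub>m n) x = complex_of_real (sq_norm_cvec x)"
  using assms complex_norm_square
  by (simp add: sesq_def sq_norm_cvec_def scalar_prod_def atLeast0LessThan mult.commute)

lemma sesq_block:
  assumes "A \<in> carrier_mat n n" "x \<in> carrier_vec n" "y \<in> carrier_vec n"
    and "F \<subseteq> {0..<n}" "C = {0..<n} - F"
  shows "sesq x A y = conjugate (subvec x C) \<bullet> subvec (A *\<^sub>v y) C
    + conjugate (subvec x F) \<bullet> subvec (A *\<^sub>v y) F"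
proof -
  have "C \<subseteq> {0..<n}"
    using assms by auto
  then show ?thesis
    using assms scalar_prod_subvec[of "conjugate x" n "A *\<^sub>v y" F C]
    by (simp add: sesq_def subvec_conjugate)
qed

section \<open>Approximation expressed through I - W\<close>

definition form_approx :: "nat \<Rightarrow> real \<Rightarrow> complex mat \<Rightarrow> complex mat \<Rightarrow> bool" where
  "form_approx n \<epsilon> L' L \<longleftrightarrow> (\<forall>x \<in> carrier_vec n. \<forall>y \<in> carrier_vec n.
     cmod (sesq x L y - sesq x L' y) \<le> \<epsilon> / 2 * (Re (sesq x L x) + Re (sesq y L y)))"

text \<open>The identities cancel in the difference up to a sign, and in the error term they absorb
  the squared norms. The equivalence serves twice: for the given matrices and for their Schur
  complements.\<close>

lemma complex_approx_one_minus_iff: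
  assumes L: "L \<in> carrier_mat n n" and L': "L' \<in> carrier_mat n n"
  shows "complex_approx n \<epsilon> (1\<^sub>m n - L') (1\<^sub>m n - L) \<longleftrightarrow> form_approx n \<epsilon> L' L"
proof -
  have "sesq x (1\<^sub>m n - L - (1\<^sub>m n - L')) y = - (sesq x L y - sesq x L' y)"
    if "x \<in> carrier_vec n" "y \<in> carrier_vec n" for x y
    using that L L' by (simp add: sesq_minus[where n = n] minus_carrier_mat)
  moreover have "sq_norm_cvec x + sq_norm_cvec y - Re (sesq x (1\<^sub>m n - L) x + sesq y (1\<^sub>m n - L) y)
      = Re (sesq x L x) + Re (sesq y L y)"
    if "x \<in> carrier_vec n" "y \<in> carrier_vec n" for x y
    using that L by (simp add: sesq_minus[where n = n] sq_norm_cvec_conv_sesq)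
  ultimately show ?thesis
    using L L' by (simp add: complex_approx_def form_approx_def norm_minus_cancel
        minus_carrier_mat del: minus_diff_eq)
qed

text \<open>Replacing \<open>x\<close> by \<open>sqrt t\<close> times \<open>x\<close> and
  \<open>y\<close> by \<open>y\<close> over \<open>sqrt t\<close> leaves the sesquilinear left side
  unchanged but reweights the two quadratic terms.\<close>

lemma form_approx_scaled:
  assumes L: "L \<in> carrier_mat n n" and L': "L' \<in> carrier_mat n n"
    and fa: "form_approx n \<epsilon> L' L" and t: "0 < t"
    and x: "x \<in> carrier_vec n" and y: "y \<in> carrier_vec n"
  shows "cmod (sesq x L y - sesq x L' y) \<le> \<epsilon> / 2 * (t * Re (sesq x L x) + Re (sesq y L y) / t)"
proof -
  define c d where "c = complex_of_real (sqrt t)" and "d = complex_of_real (1 / sqrt t)"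
  have cd: "cnj c * d = 1" "cnj c * c = of_real t" "cnj d * d = of_real (1 / t)"
    using t by (auto simp: c_def d_def simp flip: of_real_mult)
  have "cmod (sesq (c \<cdot>\<^sub>v x) L (d \<cdot>\<^sub>v y) - sesq (c \<cdot>\<^sub>v x) L' (d \<cdot>\<^sub>v y))
      \<le> \<epsilon> / 2 * (Re (sesq (c \<cdot>\<^sub>v x) L (c \<cdot>\<^sub>v x)) + Re (sesq (d \<cdot>\<^sub>v y) L (d \<cdot>\<^sub>v y)))"
    using fa x y by (simp add: form_approx_def)
  then show ?thesis
    using L L' x y by (simp add: sesq_smult cd)
qed

text \<open>For \<open>y = x\<close> the right side of the hypothesis is \<epsilon> times this real
  part and dominates a modulus.\<close>

lemma form_approx_nonneg:
  assumes "form_approx n \<epsilon> L' L" "0 < \<epsilon>" "x \<in> carrier_vec n"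
  shows "0 \<le> Re (sesq x L x)"
proof -
  have "0 \<le> \<epsilon> / 2 * (Re (sesq x L x) + Re (sesq x L x))"
    using assms norm_ge_zero order_trans unfolding form_approx_def by blast
  then show ?thesis
    using assms(2) by (simp add: zero_le_mult_iff)
qed

section \<open>Schur complements\<close>

text \<open>Guarantees that the term \<open>the (mat_inverse ...)\<close> in
  \<open>schur_complement\<close> is a genuine two-sided inverse.\<close>

lemma invertible_mat_inverseE:
  fixes A :: "'a :: field mat"
  assumes A: "A \<in> carrier_mat n n" and inv: "invertible_mat A"
  obtains B where "mat_inverse A = Some B" "B \<in> carrier_mat n n" "A * B = 1\<^sub>m n" "B * A = 1\<^sub>m n"
proof -
  obtain D where D: "A * D = 1\<^sub>m n" "D * A = 1\<^sub>m (dim_row D)"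
    using A inv by (auto simp: invertible_mat_def inverts_mat_def)
  \<comment> \<open>The predicate \<open>invertible_mat\<close> says nothing direct about the shape
    of \<open>D\<close>; it is read off from the two product identities.\<close>
  have "dim_col D = n"
    using arg_cong[OF D(1), of dim_col] by simp
  moreover have "dim_row D = n"
    using arg_cong[OF D(2), of dim_col] A by simp
  ultimately have "A \<in> Units (ring_mat TYPE('a) n ())"
    using A D by (auto simp: Units_def ring_mat_simps intro!: bexI[of _ D])
  then obtain B where "mat_inverse A = Some B"
    using mat_inverse(1)[OF A, of "()"] by (cases "mat_inverse A") auto
  then show thesis
    using that mat_inverse(2)[OF A] by blast
qed

text \<open>Over a field, a vanishing determinant would supply a nonzero kernel vector.\<close>

lemma invertible_mat_if_kernel_trivial:
  fixes A :: "'a :: field mat"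
  assumes A: "A \<in> carrier_mat n n"
    and ker: "\<And>v. v \<in> carrier_vec n \<Longrightarrow> A *\<^sub>v v = 0\<^sub>v n \<Longrightarrow> v = 0\<^sub>v n"
  shows "invertible_mat A"
proof -
  have "det A \<noteq> 0"
    using det_0_iff_vec_prod_zero_field[OF A] ker by blast
  then have "A \<in> Units (ring_mat TYPE('a) n ())"
    by (rule det_non_zero_imp_unit[OF A])
  then show ?thesis
    using A unfolding invertible_mat_def inverts_mat_def Units_def ring_mat_simps by auto
qed

lemma mult_mat_uminus_vec:
  fixes A :: "'a :: ring mat"
  assumes "A \<in> carrier_mat nr nc" "v \<in> carrier_vec nc"
  shows "A *\<^sub>v (- v) = - (A *\<^sub>v v)"
  using assms by (intro eq_vecI) auto

lemma schur_complement_carrier: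
  assumes M: "M \<in> carrier_mat n n" and F: "F \<subseteq> {0..<n}" and C: "C = {0..<n} - F"
    and inv: "invertible_mat (submatrix M F F)"
  shows "schur_complement M C \<in> carrier_mat (card C) (card C)"
proof -
  have C': "C \<subseteq> {0..<n}" and F': "{0..<dim_row M} - C = F"
    using C M F by auto
  obtain B where "mat_inverse (submatrix M F F) = Some B" "B \<in> carrier_mat (card F) (card F)"
    using invertible_mat_inverseE[OF submatrix_carrier[OF M F F] inv] by blast
  then show ?thesis
    using submatrix_carrier[OF M F C'] submatrix_carrier[OF M C' F] submatrix_carrier[OF M C' C']
    unfolding schur_complement_def F' by (auto simp: minus_carrier_mat)
qed

section \<open>Extending vectors from C to the whole index set\<close>

text \<open>Block elimination: the \<open>F\<close> part of \<open>y\<close> is chosen so that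
  \<open>M y\<close> vanishes on \<open>F\<close> and equals the Schur complement applied to
  \<open>b\<close> on \<open>C\<close>. Hence the \<open>F\<close> part of \<open>x\<close> has no
  influence.\<close>

lemma schur_complement_right_extension:
  assumes M: "M \<in> carrier_mat n n" and F: "F \<subseteq> {0..<n}" and C: "C = {0..<n} - F"
    and inv: "invertible_mat (submatrix M F F)" and b: "b \<in> carrier_vec (card C)"
  obtains y where "y \<in> carrier_vec n" "subvec y C = b"
    "\<And>x. x \<in> carrier_vec n \<Longrightarrow> sesq x M y = sesq (subvec x C) (schur_complement M C) b"
proof -
  have C': "C \<subseteq> {0..<n}" and F': "{0..<dim_row M} - C = F"
    using C M F by auto
  obtain B where B: "mat_inverse (submatrix M F F) = Some B" "B \<in> carrier_mat (card F) (card F)"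
      "submatrix M F F * B = 1\<^sub>m (card F)"
    using invertible_mat_inverseE[OF submatrix_carrier[OF M F F] inv] by blast
  let ?FF = "submatrix M F F" and ?FC = "submatrix M F C"
  let ?CF = "submatrix M C F" and ?CC = "submatrix M C C"
  note car = submatrix_carrier[OF M F F] submatrix_carrier[OF M F C']
    submatrix_carrier[OF M C' F] submatrix_carrier[OF M C' C'] B(2)
  have S: "schur_complement M C = ?CC - ?CF * B * ?FC"
    by (simp add: schur_complement_def Let_def F' B)
  define w where "w = ?FC *\<^sub>v b"
  have w: "w \<in> carrier_vec (card F)"
    using car b by (simp add: w_def)
  have "- (B *\<^sub>v w) \<in> carrier_vec (card F)"
    using car w by simp
  \<comment> \<open>This \<open>F\<close> part is the solution of
    \<open>M_FC b + M_FF y_F = 0\<close>.\<close>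
  then obtain y where y: "y \<in> carrier_vec n" "subvec y C = b" "subvec y F = - (B *\<^sub>v w)"
    using subvec_glue[OF b _ F C] by metis
  have Bw: "B *\<^sub>v w \<in> carrier_vec (card F)"
    using car w by simp
  have "?FF *\<^sub>v (B *\<^sub>v w) = w"
    using assoc_mult_mat_vec[OF car(1) car(5) w] B(3) w by simp
  then have yF: "subvec (M *\<^sub>v y) F = 0\<^sub>v (card F)"
    using subvec_mult_mat_vec[OF M y(1) F C F] w Bw car(1) y(2,3)
    by (simp add: w_def[symmetric] mult_mat_uminus_vec[where nr = "card F" and nc = "card F"])
  have "?CF * B * ?FC *\<^sub>v b = ?CF *\<^sub>v (B *\<^sub>v w)"
    using assoc_mult_mat_vec[OF mult_carrier_mat[OF car(3,5)] car(2) b]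
      assoc_mult_mat_vec[OF car(3,5) w] by (simp only: w_def)
  then have yC: "subvec (M *\<^sub>v y) C = schur_complement M C *\<^sub>v b"
    using subvec_mult_mat_vec[OF M y(1) F C C'] Bw car y(2,3) b
    by (simp add: S minus_mult_distrib_mat_vec[where nr = "card C" and nc = "card C"]
        minus_add_uminus_vec[where n = "card C"] mult_mat_uminus_vec[where nr = "card C" and nc = "card F"])
  show thesis
  proof (rule that[OF y(1,2)])
    fix x :: "complex vec" assume "x \<in> carrier_vec n"
    then show "sesq x M y = sesq (subvec x C) (schur_complement M C) b"
      using sesq_block[OF M _ y(1) F C, of x] yF yC by (simp add: sesq_def)
  qed
qed

text \<open>The mirror image by row elimination: the row given by the conjugate of \<open>x\<close>,
  multiplied by \<open>M\<close>, vanishes on \<open>F\<close>, so the \<open>F\<close> part of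
  \<open>y\<close> has no influence.\<close>

lemma schur_complement_left_extension:
  assumes M: "M \<in> carrier_mat n n" and F: "F \<subseteq> {0..<n}" and C: "C = {0..<n} - F"
    and inv: "invertible_mat (submatrix M F F)" and a: "a \<in> carrier_vec (card C)"
  obtains x where "x \<in> carrier_vec n" "subvec x C = a"
    "\<And>y. y \<in> carrier_vec n \<Longrightarrow> sesq x M y = sesq a (schur_complement M C) (subvec y C)"
proof -
  have C': "C \<subseteq> {0..<n}" and F': "{0..<dim_row M} - C = F"
    using C M F by auto
  obtain B where B: "mat_inverse (submatrix M F F) = Some B" "B \<in> carrier_mat (card F) (card F)"
      "B * submatrix M F F = 1\<^sub>m (card F)"
    using invertible_mat_inverseE[OF submatrix_carrier[OF M F F] inv] by blast
  let ?FF = "submatrix M F F" and ?FC = "submatrix M F C"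
  let ?CF = "submatrix M C F" and ?CC = "submatrix M C C"
  note car = submatrix_carrier[OF M F F] submatrix_carrier[OF M F C']
    submatrix_carrier[OF M C' F] submatrix_carrier[OF M C' C'] B(2)
  have S: "schur_complement M C = ?CC - ?CF * B * ?FC"
    by (simp add: schur_complement_def Let_def F' B)
  have CFB: "?CF * B \<in> carrier_mat (card C) (card F)"
    using car by simp
  \<comment> \<open>As a column, \<open>w\<close> is the row \<open>conjugate a\<close> times
    \<open>M_CF\<close> times the inverse of \<open>M_FF\<close>. A plain transpose is right,
    because \<open>a\<close> is already conjugated.\<close>
  define w where "w = transpose_mat (?CF * B) *\<^sub>v conjugate a"
  have w: "w \<in> carrier_vec (card F)"
    using CFB a unfolding w_def by (intro mult_mat_vec_carrier[where n = "card C"]) auto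
  have "- conjugate w \<in> carrier_vec (card F)"
    using w by simp
  then obtain x where x: "x \<in> carrier_vec n" "subvec x C = a" "subvec x F = - conjugate w"
    using subvec_glue[OF a _ F C] by metis
  have cx: "conjugate (subvec x F) = - w"
    using w by (simp add: x uminus_conjugate_vec)
  show thesis
  proof (rule that[OF x(1,2)])
    fix y :: "complex vec" assume y: "y \<in> carrier_vec n"
    define u v where "u = subvec y C" and "v = subvec y F"
    have uv: "u \<in> carrier_vec (card C)" "v \<in> carrier_vec (card F)"
      by (simp_all add: u_def v_def)
    have ca: "conjugate a \<in> carrier_vec (card C)"
      using a by simp
    have cars: "?CC *\<^sub>v u \<in> carrier_vec (card C)" "?CF *\<^sub>v v \<in> carrier_vec (card C)"
      "?FC *\<^sub>v u \<in> carrier_vec (card F)" "?FF *\<^sub>v v \<in> carrier_vec (card F)"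
      using car uv by auto
    have cars': "?CF * B * ?FC *\<^sub>v u \<in> carrier_vec (card C)"
      by (rule mult_mat_vec_carrier[OF mult_carrier_mat[OF CFB car(2)] uv(1)])
    \<comment> \<open>This makes the two terms containing \<open>v\<close> cancel once
      \<open>w\<close> enters with a minus sign.\<close>
    have "?CF * B * ?FF = ?CF"
      using assoc_mult_mat[OF car(3) car(5) car(1)] B(3) car(3) by simp
    then have "?CF * B *\<^sub>v (?FF *\<^sub>v v) = ?CF *\<^sub>v v"
      using assoc_mult_mat_vec[OF CFB car(1) uv(2)] by simp
    then have "w \<bullet> (?FC *\<^sub>v u + ?FF *\<^sub>v v)
        = conjugate a \<bullet> (?CF * B * ?FC *\<^sub>v u) + conjugate a \<bullet> (?CF *\<^sub>v v)"
      using cars cars' ca CFB car(2) uv transpose_vec_mult_scalar[OF CFB _ ca, of "?FC *\<^sub>v u + ?FF *\<^sub>v v"]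
      by (simp add: w_def mult_add_distrib_mat_vec[OF CFB] scalar_prod_add_distrib[where n = "card C"]
          assoc_mult_mat_vec[OF CFB car(2)])
    moreover have "sesq x M y = conjugate a \<bullet> (?CC *\<^sub>v u + ?CF *\<^sub>v v)
        + (- w) \<bullet> (?FC *\<^sub>v u + ?FF *\<^sub>v v)"
      using sesq_block[OF M x(1) y F C] subvec_mult_mat_vec[OF M y F C C']
        subvec_mult_mat_vec[OF M y F C F] x(2) cx by (simp add: u_def v_def)
    ultimately have "sesq x M y = conjugate a \<bullet> (?CC *\<^sub>v u) - conjugate a \<bullet> (?CF * B * ?FC *\<^sub>v u)"
      using cars ca w
      by (simp add: scalar_prod_add_distrib[where n = "card C"]
          uminus_scalar_prod[where n = "card F", symmetric])
    also have "\<dots> = sesq a (schur_complement M C) u"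
      using cars cars' ca uv car CFB unfolding S sesq_def
      by (simp add: minus_mult_distrib_mat_vec[where nr = "card C" and nc = "card C"]
          scalar_prod_minus_distrib[where n = "card C"])
    finally show "sesq x M y = sesq a (schur_complement M C) (subvec y C)"
      by (simp add: u_def)
  qed
qed

section \<open>Approximation of blocks and Schur complements\<close>

text \<open>A kernel vector of the \<open>F\<close> block of \<open>L'\<close>, extended by zero, is
  shown to be a kernel vector of the \<open>F\<close> block of \<open>L\<close>, hence zero.\<close>

lemma form_approx_block_invertible:
  assumes L: "L \<in> carrier_mat n n" and L': "L' \<in> carrier_mat n n"
    and fa: "form_approx n \<epsilon> L' L" and \<epsilon>: "0 < \<epsilon>" "\<epsilon> < 1"
    and F: "F \<subseteq> {0..<n}" and inv: "invertible_mat (submatrix L F F)"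
  shows "invertible_mat (submatrix L' F F)"
proof (rule invertible_mat_if_kernel_trivial[OF submatrix_carrier[OF L' F F]])
  fix v assume v: "v \<in> carrier_vec (card F)" and ker: "submatrix L' F F *\<^sub>v v = 0\<^sub>v (card F)"
  define C where "C = {0..<n} - F"
  have LF: "submatrix L F F \<in> carrier_mat (card F) (card F)"
    by (rule submatrix_carrier[OF L F F])
  have ext: "\<exists>x. x \<in> carrier_vec n \<and> subvec x C = 0\<^sub>v (card C) \<and> subvec x F = u"
    if "u \<in> carrier_vec (card F)" for u :: "complex vec"
    using subvec_glue[OF zero_carrier_vec that F C_def] by metis
  have form: "sesq y A x = conjugate (subvec y F) \<bullet> (submatrix A F F *\<^sub>v subvec x F)"
    if "A \<in> carrier_mat n n" "x \<in> carrier_vec n" "subvec x C = 0\<^sub>v (card C)"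
      "y \<in> carrier_vec n" "subvec y C = 0\<^sub>v (card C)" for A x y
  proof -
    have C': "C \<subseteq> {0..<n}"
      by (auto simp: C_def)
    have "submatrix A F C *\<^sub>v 0\<^sub>v (card C) = 0\<^sub>v (card F)"
      using submatrix_carrier[OF that(1) F C'] by (intro eq_vecI) auto
    then have "subvec (A *\<^sub>v x) F = submatrix A F F *\<^sub>v subvec x F"
      using subvec_mult_mat_vec[OF that(1,2) F C_def F] that(3) submatrix_carrier[OF that(1) F F]
      by (simp add: left_zero_vec[where n = "card F"])
    then show ?thesis
      using sesq_block[OF that(1,4,2) F C_def] that by simp
  qed
  obtain x where x: "x \<in> carrier_vec n" "subvec x C = 0\<^sub>v (card C)" "subvec x F = v"
    using ext[OF v] by blast
  \<comment> \<open>With this test vector, \<open>sesq y L x\<close> becomes the squared norm of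
    \<open>submatrix L F F *\<^sub>v v\<close>.\<close>
  obtain y where y: "y \<in> carrier_vec n" "subvec y C = 0\<^sub>v (card C)"
    "subvec y F = submatrix L F F *\<^sub>v v"
    using ext[of "submatrix L F F *\<^sub>v v"] LF v by auto
  have zero: "sesq z L' x = 0" if "z \<in> carrier_vec n" "subvec z C = 0\<^sub>v (card C)" for z
    using form[OF L' x(1,2) that] ker x(3) by simp
  have qx: "Re (sesq x L x) = 0"
  proof -
    have "cmod (sesq x L x) \<le> \<epsilon> * Re (sesq x L x)"
      using fa x(1) zero[OF x(1,2)] by (force simp: form_approx_def)
    then have "(1 - \<epsilon>) * Re (sesq x L x) \<le> 0"
      using complex_Re_le_cmod[of "sesq x L x"] by (simp add: algebra_simps)
    then show ?thesis
      using form_approx_nonneg[OF fa \<epsilon>(1) x(1)] \<epsilon>(2) by (simp add: mult_le_0_iff)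
  qed
  \<comment> \<open>Because the quadratic term of \<open>x\<close> is zero, shrinking the weight on
    \<open>y\<close> makes the bound arbitrarily small. The \<open>+ 1\<close> in the weight
    \<open>e / (?r + 1)\<close> covers the case \<open>?r = 0\<close>.\<close>
  have "cmod (sesq y L x) \<le> e" if "0 < e" for e
  proof -
    let ?r = "\<epsilon> / 2 * Re (sesq y L y)"
    have r: "0 \<le> ?r"
      using form_approx_nonneg[OF fa \<epsilon>(1) y(1)] \<epsilon>(1) by simp
    have "cmod (sesq y L x) \<le> e / (?r + 1) * ?r"
      using form_approx_scaled[OF L L' fa _ y(1) x(1), of "e / (?r + 1)"] zero[OF y(1,2)] qx r that
      by (simp add: mult_ac)
    also have "\<dots> \<le> e"
      using r that by (simp add: field_simps)
    finally show ?thesis .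
  qed
  then have "sesq y L x = 0"
    using field_le_epsilon[of "cmod (sesq y L x)" 0] by simp
  then have "conjugate (submatrix L F F *\<^sub>v v) \<bullet> (submatrix L F F *\<^sub>v v) = 0"
    using form[OF L x(1,2) y(1,2)] x(3) y(3) by simp
  then have Lv: "submatrix L F F *\<^sub>v v = 0\<^sub>v (card F)"
    using LF v conjugate_square_eq_0_vec[of "submatrix L F F *\<^sub>v v" "card F"]
      comm_scalar_prod[of "submatrix L F F *\<^sub>v v" "card F" "conjugate (submatrix L F F *\<^sub>v v)"] by simp
  obtain B where B: "B \<in> carrier_mat (card F) (card F)" "B * submatrix L F F = 1\<^sub>m (card F)"
    using invertible_mat_inverseE[OF LF inv] by blast
  have "v = B *\<^sub>v (submatrix L F F *\<^sub>v v)"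
    using assoc_mult_mat_vec[OF B(1) LF v] B(2) v by simp
  then show "v = 0\<^sub>v (card F)"
    using Lv B(1) by (auto intro!: eq_vecI)
qed

lemma form_approx_schur_complement:
  assumes L: "L \<in> carrier_mat n n" and L': "L' \<in> carrier_mat n n"
    and fa: "form_approx n \<epsilon> L' L" and \<epsilon>: "0 < \<epsilon>" "\<epsilon> < 1"
    and F: "F \<subseteq> {0..<n}" and C: "C = {0..<n} - F"
    and inv: "invertible_mat (submatrix L F F)" and inv': "invertible_mat (submatrix L' F F)"
  shows "form_approx (card C) (\<epsilon> / (1 - \<epsilon>)) (schur_complement L' C) (schur_complement L C)"
  unfolding form_approx_def
proof (intro ballI)
  fix a b :: "complex vec"
  assume a: "a \<in> carrier_vec (card C)" and b: "b \<in> carrier_vec (card C)"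
  define S S' where "S = schur_complement L C" and "S' = schur_complement L' C"
  \<comment> \<open>Extending \<open>a\<close> through \<open>L'\<close> on the left and
    \<open>z\<close> through \<open>L\<close> on the right lets a single pair of vectors realise
    both Schur forms, so their difference is \<open>sesq x L y - sesq x L' y\<close>.\<close>
  obtain x where x: "x \<in> carrier_vec n" "subvec x C = a"
    and xL': "\<And>y. y \<in> carrier_vec n \<Longrightarrow> sesq x L' y = sesq a S' (subvec y C)"
    using schur_complement_left_extension[OF L' F C inv' a] unfolding S'_def by metis
  \<comment> \<open>As \<open>x\<close> depends only on \<open>a\<close>, the vector
    \<open>z\<close> stays free: \<open>z = a\<close> is used to control the term in
    \<open>x\<close>, and \<open>z = b\<close> yields the conclusion.\<close>
  have key: "cmod (sesq a S z - sesq a S' z)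
      \<le> \<epsilon> / 2 * ((1 - \<epsilon>) * Re (sesq x L x) + Re (sesq z S z) / (1 - \<epsilon>))"
    if z: "z \<in> carrier_vec (card C)" for z
  proof -
    obtain y where y: "y \<in> carrier_vec n" "subvec y C = z"
      and Ly: "\<And>x. x \<in> carrier_vec n \<Longrightarrow> sesq x L y = sesq (subvec x C) S z"
      using schur_complement_right_extension[OF L F C inv z] unfolding S_def by metis
    have "cmod (sesq x L y - sesq x L' y)
        \<le> \<epsilon> / 2 * ((1 - \<epsilon>) * Re (sesq x L x) + Re (sesq y L y) / (1 - \<epsilon>))"
      using form_approx_scaled[OF L L' fa _ x(1) y(1), of "1 - \<epsilon>"] \<epsilon>(2) by simp
    then show ?thesis
      using Ly[OF x(1)] Ly[OF y(1)] xL'[OF y(1)] x(2) y(2) by simp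
  qed
  define q s where "q = (1 - \<epsilon>) * Re (sesq x L x)" and "s = Re (sesq a S a) / (1 - \<epsilon>)"
  have "cmod (sesq x L x - sesq x L' x) \<le> \<epsilon> * Re (sesq x L x)"
    using fa x(1) by (force simp: form_approx_def)
  then have "q \<le> Re (sesq a S' a)"
    using abs_Re_le_cmod[of "sesq x L x - sesq x L' x"] xL'[OF x(1)] x(2)
    by (simp add: q_def algebra_simps)
  also have "\<dots> \<le> Re (sesq a S a) + \<epsilon> / 2 * (q + s)"
    using key[OF a] abs_Re_le_cmod[of "sesq a S a - sesq a S' a"]
    unfolding q_def[symmetric] s_def[symmetric] by simp
  also have "Re (sesq a S a) = (1 - \<epsilon>) * s"
    using \<epsilon>(2) by (simp add: s_def)
  \<comment> \<open>The weight \<open>1 - \<epsilon>\<close> was chosen so that both sides carry the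
    same positive factor, which then cancels.\<close>
  finally have "(1 - \<epsilon> / 2) * q \<le> (1 - \<epsilon> / 2) * s"
    by (simp add: field_simps)
  then have "q \<le> s"
    using \<epsilon>(2) by simp
  have "cmod (sesq a S b - sesq a S' b) \<le> \<epsilon> / 2 * (q + Re (sesq b S b) / (1 - \<epsilon>))"
    using key[OF b] by (simp add: q_def)
  also have "\<dots> \<le> \<epsilon> / 2 * (s + Re (sesq b S b) / (1 - \<epsilon>))"
    using \<open>q \<le> s\<close> \<epsilon>(1) by (intro mult_left_mono) auto
  also have "\<dots> = \<epsilon> / (1 - \<epsilon>) / 2 * (Re (sesq a S a) + Re (sesq b S b))"
    by (simp add: s_def add_divide_distrib[symmetric])
  finally show "cmod (sesq a (schur_complement L C) b - sesq a (schur_complement L' C) b)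
      \<le> \<epsilon> / (1 - \<epsilon>) / 2
        * (Re (sesq a (schur_complement L C) a) + Re (sesq b (schur_complement L C) b))"
    by (simp add: S_def S'_def)
qed

text \<open>Increasing the constant is harmless since the error term is nonnegative by
  \<open>form_approx_nonneg\<close>.\<close>

lemma form_approx_mono:
  assumes fa: "form_approx n \<epsilon> L' L" and "0 < \<epsilon>" "\<epsilon> \<le> \<delta>"
  shows "form_approx n \<delta> L' L"
  unfolding form_approx_def
proof (intro ballI)
  fix x y :: "complex vec" assume xy: "x \<in> carrier_vec n" "y \<in> carrier_vec n"
  have "cmod (sesq x L y - sesq x L' y) \<le> \<epsilon> / 2 * (Re (sesq x L x) + Re (sesq y L y))"
    using fa xy by (simp add: form_approx_def)
  also have "\<dots> \<le> \<delta> / 2 * (Re (sesq x L x) + Re (sesq y L y))"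
    using assms form_approx_nonneg[OF fa] xy by (intro mult_right_mono) auto
  finally show "cmod (sesq x L y - sesq x L' y) \<le> \<delta> / 2 * (Re (sesq x L x) + Re (sesq y L y))" .
qed

text \<open>The first conjunct ensures that the Schur complement of \<open>I - W'\<close> is well
  defined; invertibility is assumed only for the block coming from \<open>W\<close>.\<close>

theorem theorem4p8:
  fixes n :: nat and W W' :: "complex mat" and \<epsilon> :: real and F C :: "nat set"
  assumes "W \<in> carrier_mat n n" and "W' \<in> carrier_mat n n"
    and "0 < \<epsilon>" and "\<epsilon> < 2 / 3"
    and "complex_approx n \<epsilon> W' W"
    and "F \<subseteq> {0..<n}"
    and "invertible_mat (1\<^sub>m (card F) - submatrix W F F)"
    and "C = {0..<n} - F"
  shows "invertible_mat (submatrix (1\<^sub>m n - W') F F) \<and>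
    complex_approx (card C) (\<epsilon> / (1 - 3 * \<epsilon> / 2))
      (1\<^sub>m (card C) - schur_complement (1\<^sub>m n - W') C)
      (1\<^sub>m (card C) - schur_complement (1\<^sub>m n - W) C)"
proof
  define L L' where "L = 1\<^sub>m n - W" and "L' = 1\<^sub>m n - W'"
  have L: "L \<in> carrier_mat n n" and L': "L' \<in> carrier_mat n n"
    using assms by (auto simp: L_def L'_def minus_carrier_mat)
  have "W = 1\<^sub>m n - L" "W' = 1\<^sub>m n - L'"
    using assms by (auto simp: L_def L'_def intro!: eq_matI)
  then have fa: "form_approx n \<epsilon> L' L"
    using assms(5) complex_approx_one_minus_iff[OF L L'] by simp
  have inv: "invertible_mat (submatrix L F F)"
    using assms by (simp add: L_def submatrix_one_minus)
  have \<epsilon>: "\<epsilon> < 1"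
    using assms by simp
  have inv': "invertible_mat (submatrix L' F F)"
    using form_approx_block_invertible[OF L L' fa assms(3) \<epsilon> assms(6) inv] .
  then show "invertible_mat (submatrix (1\<^sub>m n - W') F F)"
    by (simp add: L'_def)
  have "form_approx (card C) (\<epsilon> / (1 - \<epsilon>)) (schur_complement L' C) (schur_complement L C)"
    using form_approx_schur_complement[OF L L' fa assms(3) \<epsilon> assms(6,8) inv inv'] .
  \<comment> \<open>The bound \<epsilon> < 2/3 keeps the smaller denominator
    \<open>1 - 3 * \<epsilon> / 2\<close> positive.\<close>
  moreover have "\<epsilon> / (1 - \<epsilon>) \<le> \<epsilon> / (1 - 3 * \<epsilon> / 2)"
    using assms(3,4) by (intro divide_left_mono) auto
  ultimately have "form_approx (card C) (\<epsilon> / (1 - 3 * \<epsilon> / 2))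
      (schur_complement L' C) (schur_complement L C)"
    using form_approx_mono assms(3) \<epsilon> by simp
  then show "complex_approx (card C) (\<epsilon> / (1 - 3 * \<epsilon> / 2))
      (1\<^sub>m (card C) - schur_complement (1\<^sub>m n - W') C)
      (1\<^sub>m (card C) - schur_complement (1\<^sub>m n - W) C)"
    using complex_approx_one_minus_iff[OF schur_complement_carrier[OF L assms(6,8) inv]
        schur_complement_carrier[OF L' assms(6,8) inv']]
    by (simp add: L_def L'_def)
qed

end
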